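(* Let $k\ge 2$ be an integer and let $G=(V,E)$ be a finite, undirected, unweighted graph with $n=|V|$ vertices that is $2(k-1)$-vertex-connected and 2-vertex-connected. If $G$ contains a spanning tree with $k$ leaves, then $G$ has a TSP tour of length at most $4n/3$.
   Context: A TSP tour of $G$ is a closed walk in $G$ that visits every vertex at least once; its length is the number of edges traversed, counted with multiplicity. A leaf of a tree is a vertex of degree $1$ in the tree. *)

theory Defs
  imports Complex_Main
begin

definition simple_graph :: "'a set \<Rightarrow> 'a set set \<Rightarrow> bool" where
  "simple_graph V E \<longleftrightarrow> finite V \<and>
     (\<forall>e\<in>E. \<exists>u v. e = {u, v} \<and> u \<noteq> v \<and> u \<in> V \<and> v \<in> V)"

definition is_walk :: "'a set \<Rightarrow> 'a set set \<Rightarrow> 'a list \<Rightarrow> bool" where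
  "is_walk V E w \<longleftrightarrow> w \<noteq> [] \<and> set w \<subseteq> V \<and>
     (\<forall>i. Suc i < length w \<longrightarrow> {w ! i, w ! Suc i} \<in> E)"

definition walk_length :: "'a list \<Rightarrow> nat" where
  "walk_length w = length w - 1"

definition connected_graph :: "'a set \<Rightarrow> 'a set set \<Rightarrow> bool" where
  "connected_graph V E \<longleftrightarrow>
     (\<forall>u\<in>V. \<forall>v\<in>V. \<exists>w. is_walk V E w \<and> hd w = u \<and> last w = v)"

definition del_vertices_edges :: "'a set set \<Rightarrow> 'a set \<Rightarrow> 'a set set" where
  "del_vertices_edges E S = {e \<in> E. e \<inter> S = {}}"

definition k_vertex_connected :: "nat \<Rightarrow> 'a set \<Rightarrow> 'a set set \<Rightarrow> bool" where
  "k_vertex_connected k V E \<longleftrightarrow> card V > k \<and>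
     (\<forall>S. S \<subseteq> V \<and> card S < k \<longrightarrow> connected_graph (V - S) (del_vertices_edges E S))"

definition is_cycle :: "'a set \<Rightarrow> 'a set set \<Rightarrow> 'a list \<Rightarrow> bool" where
  "is_cycle V E c \<longleftrightarrow> length c \<ge> 3 \<and> distinct c \<and> is_walk V E c \<and> {last c, hd c} \<in> E"

definition acyclic_graph :: "'a set \<Rightarrow> 'a set set \<Rightarrow> bool" where
  "acyclic_graph V E \<longleftrightarrow> \<not> (\<exists>c. is_cycle V E c)"

definition spanning_tree :: "'a set \<Rightarrow> 'a set set \<Rightarrow> 'a set set \<Rightarrow> bool" where
  "spanning_tree V E T \<longleftrightarrow> T \<subseteq> E \<and> connected_graph V T \<and> acyclic_graph V T"

definition degree :: "'a set set \<Rightarrow> 'a \<Rightarrow> nat" where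
  "degree E v = card {e \<in> E. v \<in> e}"

definition leaves :: "'a set \<Rightarrow> 'a set set \<Rightarrow> 'a set" where
  "leaves V T = {v \<in> V. degree T v = 1}"

definition tsp_tour :: "'a set \<Rightarrow> 'a set set \<Rightarrow> 'a list \<Rightarrow> bool" where
  "tsp_tour V E w \<longleftrightarrow> is_walk V E w \<and> hd w = last w \<and> set w = V"

end

theory Submission
  imports Defs "HOL-Library.Multiset"
begin

text \<open>
  Let D be the set of odd-degree vertices of the spanning tree T. Counting degrees, a tree with k
  leaves has at most 2(k - 1) of them, so by Dirac's theorem some cycle C passes through all of D.
  Walking along C and switching at each vertex of D splits the edges of C into two D-joins J1 and
  J2. Euler tours of T + J1 and T + J2 have lengths n - 1 + |J1| and n - 1 + |J2|; walking around C
  and visiting each remaining vertex by a detour costs |C| + 2(n - |C|). Since |J1| + |J2| = |C|,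
  the three lengths add up to 4n - 2.
\<close>

section \<open>Menger's theorem\<close>

text \<open>The bound on D explains the connectivity hypothesis. In a tree the numbers deg(v) - 2
  sum to -2. The leaves contribute -k, so the other vertices contribute k - 2, and each odd one
  among them at least 1. Hence |D| <= k + (k - 2). A D-join has odd degree exactly at D, so adding
  it to T makes all degrees even. An edge lying in both T and the join is doubled, so degrees and
  tours are handled through multisets of edges. J1 has the right parity because |D| is even, which
  lets the switching close up around C; J2 has it because C has even degree everywhere. Most of the
  work lies in Dirac's theorem. A vertex x off a cycle is joined to it by a fan of paths; if a
  stretch of the cycle between the ends of two of them contains no prescribed vertex, it is replaced
  by a detour through x. The fan comes from the set version of Menger's theorem, proved for
  arbitrary finite relations because its induction deletes single arcs and so leaves the symmetric
  ones.\<close>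

definition rel_walk :: "('a \<times> 'a) set \<Rightarrow> 'a list \<Rightarrow> bool" where
  "rel_walk r p \<longleftrightarrow> p \<noteq> [] \<and> successively (\<lambda>a b. (a, b) \<in> r) p"

text \<open>\<open>S\<close> may contain vertices of \<open>A\<close> and \<open>B\<close>.
  One-vertex walks count, so every separator contains \<open>A \<inter> B\<close>.\<close>

definition separates :: "('a \<times> 'a) set \<Rightarrow> 'a set \<Rightarrow> 'a set \<Rightarrow> 'a set \<Rightarrow> bool" where
  "separates r A B S \<longleftrightarrow>
     (\<forall>p. rel_walk r p \<and> hd p \<in> A \<and> last p \<in> B \<longrightarrow> set p \<inter> S \<noteq> {})"

text \<open>A path may run through further vertices of \<open>A\<close> or \<open>B\<close>. Where
  it must meet its target only at its end, this is recovered by counting or by cutting the path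
  short.\<close>

definition linkage :: "('a \<times> 'a) set \<Rightarrow> 'a set \<Rightarrow> 'a set \<Rightarrow> 'a list set \<Rightarrow> bool" where
  "linkage r A B \<P> \<longleftrightarrow>
     (\<forall>p\<in>\<P>. rel_walk r p \<and> distinct p \<and> hd p \<in> A \<and> last p \<in> B) \<and>
     (\<forall>p\<in>\<P>. \<forall>q\<in>\<P>. p \<noteq> q \<longrightarrow> set p \<inter> set q = {})"

lemma rel_walk_mono: "rel_walk r p \<Longrightarrow> r \<subseteq> r' \<Longrightarrow> rel_walk r' p"
  unfolding rel_walk_def by (auto elim: successively_mono)

lemma rel_walk_append:
  assumes "p \<noteq> []" "q \<noteq> []"
  shows "rel_walk r (p @ q) \<longleftrightarrow> rel_walk r p \<and> rel_walk r q \<and> (last p, hd q) \<in> r"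
  using assms unfolding rel_walk_def by (auto simp: successively_append_iff)

lemma rel_walk_prefix: "rel_walk r (p @ u # q) \<Longrightarrow> rel_walk r (p @ [u])"
  unfolding rel_walk_def by (auto simp: successively_append_iff successively_Cons)

lemma rel_walk_suffix: "rel_walk r (p @ u # q) \<Longrightarrow> rel_walk r (u # q)"
  unfolding rel_walk_def by (auto simp: successively_append_iff successively_Cons)

lemma rel_walk_join: "rel_walk r (p @ [u]) \<Longrightarrow> rel_walk r (u # q) \<Longrightarrow> rel_walk r (p @ u # q)"
  unfolding rel_walk_def by (auto simp: successively_append_iff successively_Cons)

section \<open>Separators and the deletion of one arc\<close>

lemma rel_walk_avoid_fst:
  assumes "rel_walk r p" "x \<notin> set (butlast p)"
  shows "rel_walk (r - {(x, y)}) p"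
  using assms
proof (induction p rule: induct_list012)
  case (3 a b p)
  then show ?case by (auto simp: rel_walk_def split: if_splits)
qed (auto simp: rel_walk_def)

lemma rel_walk_avoid_snd:
  assumes "rel_walk r p" "y \<notin> set (tl p)"
  shows "rel_walk (r - {(x, y)}) p"
  using assms
proof (induction p rule: induct_list012)
  case (3 a b p)
  then show ?case by (auto simp: rel_walk_def)
qed (auto simp: rel_walk_def)

lemma separates_insert_fst:
  assumes "separates (r - {(x, y)}) A B S"
  shows "separates r A B (insert x S)"
  unfolding separates_def
proof (intro allI impI)
  fix p assume p: "rel_walk r p \<and> hd p \<in> A \<and> last p \<in> B"
  show "set p \<inter> insert x S \<noteq> {}"
  proof (cases "x \<in> set p")
    case False
    then have "rel_walk (r - {(x, y)}) p"
      using p rel_walk_avoid_fst in_set_butlastD by metis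
    with p assms show ?thesis by (auto simp: separates_def)
  qed auto
qed

lemma separates_insert_snd:
  assumes "separates (r - {(x, y)}) A B S"
  shows "separates r A B (insert y S)"
  unfolding separates_def
proof (intro allI impI)
  fix p assume p: "rel_walk r p \<and> hd p \<in> A \<and> last p \<in> B"
  show "set p \<inter> insert y S \<noteq> {}"
  proof (cases "y \<in> set p")
    case False
    then have "rel_walk (r - {(x, y)}) p"
      using p rel_walk_avoid_snd list.set_sel(2) rel_walk_def by metis
    with p assms show ?thesis by (auto simp: separates_def)
  qed auto
qed

text \<open>Cut an A-B walk at its first vertex in \<open>insert x S\<close>. This piece can contain
  \<open>x\<close> only as its last vertex, so it does not use the arc \<open>(x, y)\<close>, and
  \<open>Q\<close> already meets it.\<close>

lemma separates_through_fst:
  assumes "separates r A B (insert x S)" "separates (r - {(x, y)}) A (insert x S) Q"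
  shows "separates r A B Q"
  unfolding separates_def
proof (intro allI impI)
  fix p assume p: "rel_walk r p \<and> hd p \<in> A \<and> last p \<in> B"
  then have "\<exists>z\<in>set p. z \<in> insert x S" using assms(1) by (auto simp: separates_def)
  then obtain p1 z p2 where z: "p = p1 @ z # p2" "z \<in> insert x S" "\<forall>u\<in>set p1. u \<notin> insert x S"
    using split_list_first_prop[OF \<open>\<exists>z\<in>set p. z \<in> insert x S\<close>] by metis
  have "rel_walk r (p1 @ [z])" using p z(1) rel_walk_prefix[of r p1 z p2] by simp
  then have "rel_walk (r - {(x, y)}) (p1 @ [z])"
    by (rule rel_walk_avoid_fst) (use z in auto)
  moreover have "hd (p1 @ [z]) \<in> A" using p z by (cases p1) auto
  ultimately have "set (p1 @ [z]) \<inter> Q \<noteq> {}"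
    using assms(2) z(2) unfolding separates_def by (metis last_snoc)
  then show "set p \<inter> Q \<noteq> {}" using z by auto
qed

text \<open>Mirror image: cut at the last vertex in \<open>insert y S\<close>; the remaining piece
  never enters \<open>y\<close> again.\<close>

lemma separates_through_snd:
  assumes "separates r A B (insert y S)" "separates (r - {(x, y)}) (insert y S) B Q"
  shows "separates r A B Q"
  unfolding separates_def
proof (intro allI impI)
  fix p assume p: "rel_walk r p \<and> hd p \<in> A \<and> last p \<in> B"
  then have "\<exists>z\<in>set p. z \<in> insert y S" using assms(1) by (auto simp: separates_def)
  then obtain p1 z p2 where z: "p = p1 @ z # p2" "z \<in> insert y S" "\<forall>u\<in>set p2. u \<notin> insert y S"
    using split_list_last_prop[OF \<open>\<exists>z\<in>set p. z \<in> insert y S\<close>] by metis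
  have "rel_walk r (z # p2)" using p z(1) rel_walk_suffix[of r p1 z p2] by simp
  then have "rel_walk (r - {(x, y)}) (z # p2)"
    by (rule rel_walk_avoid_snd) (use z in auto)
  moreover have "last (z # p2) \<in> B" using p z by auto
  ultimately have "set (z # p2) \<inter> Q \<noteq> {}"
    using assms(2) z(2) unfolding separates_def by (metis list.sel(1))
  then show "set p \<inter> Q \<noteq> {}" using z by auto
qed

section \<open>Counting ends and gluing linkages\<close>

lemma linkage_last_inj: "linkage r A B \<P> \<Longrightarrow> inj_on last \<P>"
  unfolding linkage_def inj_on_def rel_walk_def by (metis disjoint_iff last_in_set)

lemma linkage_hd_inj: "linkage r A B \<P> \<Longrightarrow> inj_on hd \<P>"
  unfolding linkage_def inj_on_def rel_walk_def by (metis disjoint_iff hd_in_set)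

text \<open>Disjoint paths have different ends, so equal cardinality makes \<open>last\<close> hit
  all of \<open>B\<close>. A vertex of \<open>B\<close> on a path is then the end of some path, and
  disjointness makes it the end of this one.\<close>

lemma linkage_onto_last:
  assumes "linkage r A B \<P>" "finite B" "card \<P> = card B"
  shows "last ` \<P> = B" and "p \<in> \<P> \<Longrightarrow> z \<in> set p \<Longrightarrow> z \<in> B \<Longrightarrow> z = last p"
proof -
  have "last ` \<P> \<subseteq> B" using assms(1) by (auto simp: linkage_def)
  moreover have "card (last ` \<P>) = card B"
    using linkage_last_inj[OF assms(1)] assms(3) by (simp add: card_image)
  ultimately show *: "last ` \<P> = B" using assms(2) by (simp add: card_subset_eq)
  show "z = last p" if zp: "p \<in> \<P>" "z \<in> set p" "z \<in> B"
  proof -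
    obtain q where "q \<in> \<P>" "z = last q" using * zp(3) by blast
    with zp assms(1) show ?thesis
      unfolding linkage_def rel_walk_def by (metis disjoint_iff last_in_set)
  qed
qed

lemma linkage_onto_hd:
  assumes "linkage r A B \<P>" "finite A" "card \<P> = card A"
  shows "hd ` \<P> = A" and "p \<in> \<P> \<Longrightarrow> z \<in> set p \<Longrightarrow> z \<in> A \<Longrightarrow> z = hd p"
proof -
  have "hd ` \<P> \<subseteq> A" using assms(1) by (auto simp: linkage_def)
  moreover have "card (hd ` \<P>) = card A"
    using linkage_hd_inj[OF assms(1)] assms(3) by (simp add: card_image)
  ultimately show *: "hd ` \<P> = A" using assms(2) by (simp add: card_subset_eq)
  show "z = hd p" if zp: "p \<in> \<P>" "z \<in> set p" "z \<in> A"
  proof -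
    obtain q where "q \<in> \<P>" "z = hd q" using * zp(3) by blast
    with zp assms(1) show ?thesis
      unfolding linkage_def rel_walk_def by (metis disjoint_iff hd_in_set)
  qed
qed

text \<open>By counting, \<P> ends exactly in S + x and \<Q> starts exactly in S + y. Paths are
  glued at their common vertices in \<open>S\<close>, and the arc \<open>(x, y)\<close> joins the
  remaining two.\<close>

lemma linkage_compose:
  assumes sep: "separates r' A B S" and r: "r' \<subseteq> r" "(x, y) \<in> r"
    and S: "finite S" "x \<notin> S" "y \<notin> S"
    and P: "linkage r' A (insert x S) \<P>" "card \<P> = Suc (card S)"
    and Q: "linkage r' (insert y S) B \<Q>" "card \<Q> = Suc (card S)"
  shows "\<exists>\<R>. linkage r A B \<R> \<and> card \<R> = Suc (card S)"
proof -
  have Pl: "last ` \<P> = insert x S"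
      "\<And>p z. p \<in> \<P> \<Longrightarrow> z \<in> set p \<Longrightarrow> z \<in> insert x S \<Longrightarrow> z = last p"
    using linkage_onto_last[OF P(1)] P(2) S by auto
  have Qh: "hd ` \<Q> = insert y S"
      "\<And>q z. q \<in> \<Q> \<Longrightarrow> z \<in> set q \<Longrightarrow> z \<in> insert y S \<Longrightarrow> z = hd q"
    using linkage_onto_hd[OF Q(1)] Q(2) S by auto
  have Pw: "rel_walk r' p" "p \<noteq> []" "distinct p" "hd p \<in> A" "last p \<in> insert x S" if "p \<in> \<P>" for p
    using P(1) that by (auto simp: linkage_def rel_walk_def)
  have Qw: "rel_walk r' q" "q \<noteq> []" "distinct q" "last q \<in> B" if "q \<in> \<Q>" for q
    using Q(1) that by (auto simp: linkage_def rel_walk_def)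
  \<comment> \<open>A meeting point of p and q yields an A-B walk along p and then q, which has to pass through S.\<close>
  have meet: "u = last p \<and> u = hd q \<and> u \<in> S"
    if pq: "p \<in> \<P>" "q \<in> \<Q>" and u: "u \<in> set p" "u \<in> set q" for p q u
  proof -
    obtain p1 p2 where p: "p = p1 @ u # p2" using u by (meson split_list)
    obtain q1 q2 where q: "q = q1 @ u # q2" using u by (meson split_list)
    have w: "rel_walk r' (p1 @ u # q2)"
      using rel_walk_join[OF rel_walk_prefix rel_walk_suffix] Pw(1)[OF pq(1)] Qw(1)[OF pq(2)] p q
      by metis
    have "hd (p1 @ u # q2) \<in> A" using Pw(4)[OF pq(1)] p by (cases p1) auto
    moreover have "last (p1 @ u # q2) \<in> B" using Qw(4)[OF pq(2)] q by auto
    ultimately obtain z where z: "z \<in> S" "z \<in> set (p1 @ u # q2)"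
      using sep w unfolding separates_def by blast
    \<comment> \<open>\<open>q\<close> meets \<open>S\<close> only at its head and \<open>p\<close>
      only at its end, so the vertex of \<open>S\<close> on the spliced walk can only be
      \<open>u\<close> itself.\<close>
    have "z \<notin> set q2"
    proof
      assume "z \<in> set q2"
      with Qh(2)[OF pq(2), of z] z q have "hd q \<in> set q2" by auto
      with Qw(3)[OF pq(2)] q show False by (cases q1) auto
    qed
    with z have z1: "z \<in> set (p1 @ [u])" by auto
    with Pl(2)[OF pq(1), of z] z p have "z = last p" by auto
    with z1 Pw(3)[OF pq(1)] p have "p2 = []" by (cases p2 rule: rev_cases) auto
    with p \<open>z = last p\<close> have "u = last p" "u = z" by auto
    then show ?thesis using Qh(2)[OF pq(2) u(2)] z by auto
  qed
  \<comment> \<open>The partner of \<open>p\<close> starts where \<open>p\<close> ends, or at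
    \<open>y\<close> if \<open>p\<close> ends at \<open>x\<close>.\<close>
  have "\<forall>p\<in>\<P>. \<exists>q\<in>\<Q>. hd q = (if last p = x then y else last p)"
  proof
    fix p assume "p \<in> \<P>"
    then have "(if last p = x then y else last p) \<in> hd ` \<Q>" using Qh(1) Pw(5) by auto
    then show "\<exists>q\<in>\<Q>. hd q = (if last p = x then y else last p)" by (metis imageE)
  qed
  then obtain g where g: "\<And>p. p \<in> \<P> \<Longrightarrow> g p \<in> \<Q>"
      "\<And>p. p \<in> \<P> \<Longrightarrow> hd (g p) = (if last p = x then y else last p)"
    by metis
  have g_inj: "p = q" if "p \<in> \<P>" "q \<in> \<P>" "g p = g q" for p q
  proof -
    have "last p = last q" using g(2)[OF that(1)] g(2)[OF that(2)] that(3)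
        Pw(5)[OF that(1)] Pw(5)[OF that(2)] S
      by (auto split: if_splits)
    then show ?thesis using linkage_last_inj[OF P(1)] that by (auto dest: inj_onD)
  qed
  \<comment> \<open>After \<open>x\<close> the partner is appended whole, its head \<open>y\<close>
    being reached by the new arc; otherwise \<open>tl\<close> drops the vertex of \<open>S\<close>
    that both paths share.\<close>
  define j where "j p = p @ (if last p = x then g p else tl (g p))" for p
  have j_set: "set (j p) \<subseteq> set p \<union> set (g p)" if "p \<in> \<P>" for p
    using Qw(2)[OF g(1)[OF that]] by (auto simp: j_def dest: list.set_sel(2))
  have j_path: "rel_walk r (j p) \<and> distinct (j p) \<and> hd (j p) \<in> A \<and> last (j p) \<in> B"
    if p: "p \<in> \<P>" for p
  proof (cases "last p = x")
    case True
    then have "set p \<inter> set (g p) = {}" using meet[OF p g(1)[OF p]] S by auto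
    moreover have "rel_walk r p" "rel_walk r (g p)"
      using rel_walk_mono[OF Pw(1)[OF p] r(1)] rel_walk_mono[OF Qw(1)[OF g(1)[OF p]] r(1)] .
    ultimately show ?thesis
      using True Pw[OF p] Qw[OF g(1)[OF p]] g(2)[OF p] r(2)
      by (simp add: j_def rel_walk_append)
  next
    case False
    obtain p' l where p': "p = p' @ [l]" using Pw(2)[OF p] by (cases p rule: rev_cases) auto
    obtain q' where q: "g p = l # q'" using Qw(2)[OF g(1)[OF p]] g(2)[OF p] False p'
      by (cases "g p") auto
    have "rel_walk r' (p' @ l # q')"
      by (rule rel_walk_join) (use Pw(1)[OF p] Qw(1)[OF g(1)[OF p]] p' q in simp_all)
    moreover have j: "j p = p' @ l # q'"
      using False q p' by (simp add: j_def)
    ultimately have "rel_walk r (j p)" using rel_walk_mono[OF _ r(1)] by simp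
    moreover have "set p \<inter> set q' = {}"
      using meet[OF p g(1)[OF p]] q Qw(3)[OF g(1)[OF p]] by auto
    ultimately show ?thesis
      using Pw[OF p] Qw[OF g(1)[OF p]] p' q j by (auto simp: hd_append)
  qed
  have j_disj: "set (j p) \<inter> set (j q) = {}" if pq: "p \<in> \<P>" "q \<in> \<P>" "p \<noteq> q" for p q
  proof -
    have 1: "set p \<inter> set q = {}" using P(1) pq by (auto simp: linkage_def)
    have "g p \<noteq> g q" using g_inj pq by auto
    then have 2: "set (g p) \<inter> set (g q) = {}" using Q(1) g(1) pq by (auto simp: linkage_def)
    \<comment> \<open>A path meets no partner but its own: by \<open>meet\<close>, a common vertex
      lies in \<open>S\<close> and is both the end of \<open>p'\<close> and the head of
      \<open>g q'\<close>, so \<open>p'\<close> and \<open>q'\<close> would end alike.\<close>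
    have 3: "set p' \<inter> set (g q') = {}" if p': "p' \<in> \<P>" "q' \<in> \<P>" "p' \<noteq> q'" for p' q'
    proof (rule ccontr)
      assume "set p' \<inter> set (g q') \<noteq> {}"
      then obtain u where "u = last p'" "u = hd (g q')" "u \<in> S"
        using meet[OF p'(1) g(1)[OF p'(2)]] by blast
      then have "last p' = last q'" using g(2)[OF p'(2)] S by (auto split: if_splits)
      then show False using linkage_last_inj[OF P(1)] p' by (auto dest: inj_onD)
    qed
    show ?thesis using j_set[OF pq(1)] j_set[OF pq(2)] 1 2 3[OF pq] 3[of q p] pq by blast
  qed
  have "inj_on j \<P>"
  proof (rule inj_onI, rule ccontr)
    fix p q assume "p \<in> \<P>" "q \<in> \<P>" "j p = j q" "p \<noteq> q"
    then have "set (j p) = {}" using j_disj[of p q] by simp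
    then show False using j_path[OF \<open>p \<in> \<P>\<close>] by (simp add: rel_walk_def)
  qed
  then have "card (j ` \<P>) = Suc (card S)" using P(2) by (simp add: card_image)
  moreover have "linkage r A B (j ` \<P>)"
    unfolding linkage_def using j_path j_disj by blast
  ultimately show ?thesis by blast
qed

text \<open>
  Goering's induction: if deleting the arc (x, y) creates a separator S that is too small, then
  S + x and S + y separate in the full relation, so the induction hypothesis links A to S + x
  and S + y to B.
\<close>

theorem menger:
  fixes r :: "('a \<times> 'a) set"
  assumes "finite r" "finite A"
    and "\<And>S. finite S \<Longrightarrow> separates r A B S \<Longrightarrow> s \<le> card S"
  shows "\<exists>\<P>. linkage r A B \<P> \<and> card \<P> = s"
  using assms
proof (induction r arbitrary: A B rule: finite_induct)
  case empty
  \<comment> \<open>Without arcs every walk is a single vertex, so \<open>A \<inter> B\<close>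
    separates, and one-vertex paths form the linkage.\<close>
  have "separates {} A B (A \<inter> B)" unfolding separates_def
  proof (intro allI impI)
    fix p :: "'a list" assume "rel_walk {} p \<and> hd p \<in> A \<and> last p \<in> B"
    then show "set p \<inter> (A \<inter> B) \<noteq> {}"
      by (cases p rule: remdups_adj.cases) (auto simp: rel_walk_def)
  qed
  with empty.prems(2)[of "A \<inter> B"] empty.prems(1) have "s \<le> card (A \<inter> B)" by blast
  then obtain Z where Z: "Z \<subseteq> A \<inter> B" "card Z = s"
    by (rule obtain_subset_with_card_n)
  have "linkage {} A B ((\<lambda>z. [z]) ` Z)"
    using Z by (auto simp: linkage_def rel_walk_def)
  moreover have "card ((\<lambda>z. [z]) ` Z) = s"
    using Z by (simp add: card_image inj_on_def)
  ultimately show ?case by blast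
next
  case (insert e r)
  obtain x y where e: "e = (x, y)" by (cases e)
  have r: "insert e r - {(x, y)} = r" using insert.hyps e by auto
  show ?case
  proof (cases "\<forall>S. finite S \<and> separates r A B S \<longrightarrow> s \<le> card S")
    case True
    then obtain \<P> where "linkage r A B \<P>" "card \<P> = s"
      using insert.IH[OF insert.prems(1)] by blast
    moreover from this have "linkage (insert e r) A B \<P>"
      unfolding linkage_def using rel_walk_mono[of r _ "insert e r"] by blast
    ultimately show ?thesis by blast
  next
    case False
    then obtain S where S: "finite S" "separates r A B S" "card S < s" by force
    have sx: "separates (insert e r) A B (insert x S)"
      using separates_insert_fst[of "insert e r" x y A B S] S r by simp
    have sy: "separates (insert e r) A B (insert y S)"
      using separates_insert_snd[of "insert e r" x y A B S] S r by simp
    \<comment> \<open>Both sets separate in the full relation, so they have at least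
      \<open>s\<close> elements although \<open>S\<close> has fewer. Hence \<open>S\<close> has
      exactly s - 1 elements and contains neither \<open>x\<close> nor \<open>y\<close>.\<close>
    have "s \<le> card (insert x S)" "s \<le> card (insert y S)"
      using insert.prems(2) sx sy S(1) by auto
    with S have xy: "x \<notin> S" "y \<notin> S" and s: "s = Suc (card S)"
      by (auto simp: card_insert_if split: if_splits)
    have "s \<le> card Q" if "finite Q" "separates r A (insert x S) Q" for Q
      using separates_through_fst[OF sx, of y Q] that r insert.prems(2) by simp
    then obtain \<P> where P: "linkage r A (insert x S) \<P>" "card \<P> = s"
      using insert.IH[OF insert.prems(1)] by blast
    have "s \<le> card Q" if "finite Q" "separates r (insert y S) B Q" for Q
      using separates_through_snd[OF sy, of x Q] that r insert.prems(2) by simp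
    then obtain \<Q> where Q: "linkage r (insert y S) B \<Q>" "card \<Q> = s"
      using insert.IH[of "insert y S" B] S(1) by blast
    show ?thesis
      unfolding s
    proof (rule linkage_compose[OF S(2) _ _ S(1) xy P(1) _ Q(1)])
      show "r \<subseteq> insert e r" "(x, y) \<in> insert e r" using e by auto
    qed (use P Q s in simp_all)
  qed
qed

section \<open>Walks and Euler tours\<close>

text \<open>Each edge becomes an arc in both directions, so that results on relations apply to
  undirected graphs.\<close>

definition arcs :: "'a set set \<Rightarrow> ('a \<times> 'a) set" where
  "arcs E = {(a, b). {a, b} \<in> E}"

lemma is_walk_iff: "is_walk V E w \<longleftrightarrow> rel_walk (arcs E) w \<and> set w \<subseteq> V"
  by (auto simp: is_walk_def rel_walk_def arcs_def successively_conv_nth)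

lemma rel_walk_arcs_rev: "rel_walk (arcs E) (rev p) \<longleftrightarrow> rel_walk (arcs E) p"
  by (simp add: rel_walk_def arcs_def insert_commute)

lemma rel_walk_crossing:
  assumes "rel_walk r p" "hd p \<in> S" "last p \<notin> S"
  shows "\<exists>a b. (a, b) \<in> r \<and> a \<in> S \<and> b \<notin> S \<and> a \<in> set p \<and> b \<in> set p"
  using assms
proof (induction p rule: induct_list012)
  case (3 x y p)
  show ?case
  proof (cases "y \<in> S")
    case True
    then show ?thesis using 3 by (auto simp: rel_walk_def)
  next
    case False
    then show ?thesis using 3 by (auto simp: rel_walk_def)
  qed
qed (auto simp: rel_walk_def)

lemma connected_crossing:
  assumes "connected_graph V T" "u \<in> V \<inter> S" "v \<in> V - S"
  shows "\<exists>a b. {a, b} \<in> T \<and> a \<in> V \<inter> S \<and> b \<in> V - S"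
proof -
  obtain w where w: "is_walk V T w" "hd w = u" "last w = v"
    using assms unfolding connected_graph_def by blast
  then have "rel_walk (arcs T) w" "set w \<subseteq> V" by (auto simp: is_walk_iff)
  with rel_walk_crossing[of "arcs T" w S] w assms show ?thesis
    by (auto simp: arcs_def)
qed

section \<open>Edge multisets and degree parity\<close>

fun walk_edges :: "'a list \<Rightarrow> 'a set multiset" where
  "walk_edges (x # y # p) = add_mset {x, y} (walk_edges (y # p))"
| "walk_edges _ = {#}"

text \<open>A loop \<open>{x}\<close> counts only once, so the parity arguments ask for edges with
  two elements.\<close>

definition mdegree :: "'a set multiset \<Rightarrow> 'a \<Rightarrow> nat" where
  "mdegree M v = size (filter_mset (\<lambda>e. v \<in> e) M)"

lemma mdegree_simps [simp]:
  "mdegree {#} v = 0"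
  "mdegree (add_mset e M) v = (if v \<in> e then Suc (mdegree M v) else mdegree M v)"
  "mdegree (M + N) v = mdegree M v + mdegree N v"
  by (auto simp: mdegree_def)

lemma mdegree_pos_iff: "mdegree M v > 0 \<longleftrightarrow> (\<exists>e\<in>#M. v \<in> e)"
  by (induction M) auto

lemma mdegree_diff: "N \<subseteq># M \<Longrightarrow> mdegree M v = mdegree N v + mdegree (M - N) v"
  by (metis mdegree_simps(3) subset_mset.add_diff_inverse)

lemma mdegree_mset_set: "finite F \<Longrightarrow> mdegree (mset_set F) v = degree F v"
  by (simp add: mdegree_def degree_def filter_mset_mset_set)

lemma walk_edges_join: "walk_edges (p @ u # q) = walk_edges (p @ [u]) + walk_edges (u # q)"
  by (induction p rule: induct_list012) auto

lemma walk_edges_snoc: "p \<noteq> [] \<Longrightarrow> walk_edges (p @ [z]) = add_mset {last p, z} (walk_edges p)"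
  by (induction p rule: induct_list012) auto

lemma size_walk_edges: "size (walk_edges p) = length p - 1"
  by (induction p rule: induct_list012) auto

lemma walk_edges_subset: "e \<in># walk_edges p \<Longrightarrow> e \<subseteq> set p"
  by (induction p rule: induct_list012) auto

lemma rel_walk_arcs_iff: "rel_walk (arcs E) p \<longleftrightarrow> p \<noteq> [] \<and> set_mset (walk_edges p) \<subseteq> E"
  by (induction p rule: induct_list012) (auto simp: rel_walk_def arcs_def)

text \<open>Every visit inside the walk uses one edge to enter and one to leave. Only the two ends
  can be odd, and they cancel if they coincide.\<close>

lemma odd_mdegree_walk:
  assumes "p \<noteq> []" "\<forall>e\<in>#walk_edges p. card e = 2"
  shows "odd (mdegree (walk_edges p) v) \<longleftrightarrow> (v = hd p) \<noteq> (v = last p)"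
  using assms
proof (induction p rule: induct_list012)
  case (3 x y p)
  then have "x \<noteq> y" by auto
  with 3 show ?case by auto
qed auto

text \<open>A longest trail from \<open>a\<close> within \<open>M\<close> has used every edge at its
  last vertex. Degrees in \<open>M\<close> are even, so that vertex has even degree in the trail,
  which forces it to be \<open>a\<close>.\<close>

lemma closed_trail_at:
  assumes card2: "\<forall>e\<in>#M. card e = 2" and even: "\<forall>v. even (mdegree M v)"
    and a: "mdegree M a > 0"
  shows "\<exists>w. length w \<ge> 2 \<and> hd w = a \<and> last w = a \<and> walk_edges w \<subseteq># M"
proof -
  define P where "P w \<longleftrightarrow> w \<noteq> [] \<and> hd w = a \<and> walk_edges w \<subseteq># M" for w
  have "\<forall>w. P w \<longrightarrow> length w < size M + 2"
  proof (intro allI impI)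
    fix w assume "P w"
    then have "size (walk_edges w) \<le> size M" by (auto simp: P_def intro: size_mset_mono)
    then show "length w < size M + 2" by (simp add: size_walk_edges)
  qed
  moreover have "P [a]" by (auto simp: P_def)
  ultimately obtain w where w: "P w" and max: "\<And>w'. P w' \<Longrightarrow> length w' \<le> length w"
    using ex_has_greatest_nat[of P "[a]" length "size M + 2"] by blast
  have stuck: "mdegree (M - walk_edges w) (last w) = 0"
  proof (rule ccontr)
    assume "mdegree (M - walk_edges w) (last w) \<noteq> 0"
    then obtain e where e: "e \<in># M - walk_edges w" "last w \<in> e"
      by (meson gr0I mdegree_pos_iff)
    then have "card e = 2" using card2 by (meson in_diffD)
    then obtain z where z: "e = {last w, z}" using e(2) by (auto simp: card_2_iff)
    have "add_mset e (walk_edges w) \<subseteq># M"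
      using e(1) w unfolding P_def
      by (metis add_mset_add_single mset_subset_eq_single subset_mset.add_left_mono subset_mset.add_diff_inverse)
    then have "P (w @ [z])" using w z by (auto simp: P_def walk_edges_snoc)
    then show False using max by fastforce
  qed
  have sub: "walk_edges w \<subseteq># M" and ne: "w \<noteq> []" and hd: "hd w = a" using w by (auto simp: P_def)
  have "even (mdegree (walk_edges w) (last w))"
    using mdegree_diff[OF sub, of "last w"] stuck even by (metis add_0_right)
  moreover have "\<forall>e\<in>#walk_edges w. card e = 2" using card2 sub by (meson mset_subset_eqD)
  ultimately have "last w = a" using odd_mdegree_walk[OF ne, of "last w"] hd by auto
  moreover have "length w \<ge> 2"
  proof (rule ccontr)
    assume "\<not> length w \<ge> 2"
    with ne hd have "w = [a]" by (cases w rule: remdups_adj.cases) auto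
    with stuck a show False by simp
  qed
  ultimately show ?thesis using hd sub by blast
qed

theorem euler_tour:
  assumes card2: "\<forall>e\<in>#M. card e = 2" and even: "\<forall>v. even (mdegree M v)"
    and inV: "\<forall>e\<in>#M. e \<subseteq> V" and "V \<noteq> {}"
    and T: "connected_graph V T" "T \<subseteq> set_mset M"
  shows "\<exists>w. w \<noteq> [] \<and> hd w = last w \<and> set w = V \<and> walk_edges w \<subseteq># M"
proof -
  obtain r where r: "r \<in> V" using \<open>V \<noteq> {}\<close> by blast
  define P where "P w \<longleftrightarrow> w \<noteq> [] \<and> hd w = last w \<and> set w \<subseteq> V \<and> walk_edges w \<subseteq># M" for w
  have "\<forall>w. P w \<longrightarrow> length w < size M + 2"
  proof (intro allI impI)
    fix w assume "P w"
    then have "size (walk_edges w) \<le> size M" by (auto simp: P_def intro: size_mset_mono)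
    then show "length w < size M + 2" by (simp add: size_walk_edges)
  qed
  moreover have "P [r]" using r by (auto simp: P_def)
  ultimately obtain w where w: "P w" and max: "\<And>w'. P w' \<Longrightarrow> length w' \<le> length w"
    using ex_has_greatest_nat[of P "[r]" length "size M + 2"] by blast
  have sub: "walk_edges w \<subseteq># M" and ne: "w \<noteq> []" and cl: "hd w = last w" and wV: "set w \<subseteq> V"
    using w by (auto simp: P_def)
  have "V \<subseteq> set w"
  proof (rule ccontr)
    assume "\<not> V \<subseteq> set w"
    then obtain v where "v \<in> V - set w" by blast
    moreover have "hd w \<in> V \<inter> set w" using ne wV by auto
    ultimately obtain a b where ab: "{a, b} \<in> T" "a \<in> set w" "b \<notin> set w"
      using connected_crossing[OF T(1)] by blast
    let ?N = "M - walk_edges w"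
    have "{a, b} \<notin># walk_edges w" using walk_edges_subset[of "{a, b}" w] ab by auto
    moreover have "{a, b} \<in># M" using ab T by auto
    ultimately have "{a, b} \<in># ?N" by (simp add: in_diff_count not_in_iff)
    then have "mdegree ?N a > 0"
      unfolding mdegree_pos_iff by blast
    moreover have wcard: "\<forall>e\<in>#walk_edges w. card e = 2" using card2 sub by (meson mset_subset_eqD)
    have "\<forall>v. even (mdegree ?N v)"
    proof
      fix v
      have "even (mdegree (walk_edges w) v)" using odd_mdegree_walk[OF ne wcard] cl by auto
      then show "even (mdegree ?N v)" using mdegree_diff[OF sub, of v] even by (metis even_add)
    qed
    moreover have "\<forall>e\<in>#?N. card e = 2" using card2 by (meson in_diffD)
    ultimately obtain q where q: "length q \<ge> 2" "hd q = a" "last q = a" "walk_edges q \<subseteq># ?N"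
      using closed_trail_at[of ?N a] by auto
    obtain q' where q': "q = a # q' @ [a]"
      using q(1-3) by (cases q; cases "tl q" rule: rev_cases) auto
    obtain w1 w2 where w12: "w = w1 @ a # w2" using ab(2) by (meson split_list)
    let ?w = "w1 @ q @ w2"
    have "walk_edges ?w = walk_edges (w1 @ [a]) + walk_edges q + walk_edges (a # w2)"
      using walk_edges_join[of w1 a "q' @ a # w2"] walk_edges_join[of "a # q'" a w2] q' by simp
    then have eq: "walk_edges ?w = walk_edges w + walk_edges q"
      using walk_edges_join[of w1 a w2] w12 by simp
    have "walk_edges w + walk_edges q \<subseteq># walk_edges w + ?N" using q(4) by simp
    then have "walk_edges ?w \<subseteq># M" using eq sub by simp
    moreover have "set ?w \<subseteq> V"
    proof -
      have "x \<in> V" if x: "x \<in> set q" for x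
      proof (cases "x = a")
        case False
        then obtain s t where st: "q = s @ x # t" "s \<noteq> []"
          using x q(2) by (metis append_Nil list.sel(1) split_list)
        then have "{last s, x} \<in># walk_edges q"
          using walk_edges_join[of s x t] walk_edges_snoc[of s x] by simp
        then have "{last s, x} \<in># M" using q(4) by (meson in_diffD mset_subset_eqD)
        then show ?thesis using inV by auto
      qed (use ab wV in auto)
      then show ?thesis using wV w12 by auto
    qed
    moreover have "hd ?w = last ?w" using cl w12 q' by (cases w1; cases w2) auto
    ultimately have "P ?w" using q' by (auto simp: P_def)
    then have "length ?w \<le> length w" by (rule max)
    then show False using q(1) w12 by simp
  qed
  then show ?thesis using sub ne cl wV by blast
qed

text \<open>By connectivity some edge leads from the walk to a missed vertex; going there and back
  costs two edges.\<close>

lemma extend_closed_walk: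
  assumes "connected_graph V E" "finite V" "is_walk V E w" "hd w = last w"
  shows "\<exists>w'. tsp_tour V E w' \<and> walk_length w' = walk_length w + 2 * card (V - set w)"
  using assms(3,4)
proof (induction "card (V - set w)" arbitrary: w)
  case 0
  then have "V \<subseteq> set w" using assms(2) by simp
  then have "tsp_tour V E w" using 0 by (auto simp: tsp_tour_def is_walk_def)
  then show ?case using 0 by auto
next
  case (Suc n)
  have ne: "w \<noteq> []" "set w \<subseteq> V" "rel_walk (arcs E) w" using Suc.prems by (auto simp: is_walk_iff rel_walk_def)
  obtain v where "v \<in> V - set w" using Suc.hyps(2) by (metis all_not_in_conv card.empty nat.distinct(1))
  moreover have "hd w \<in> V \<inter> set w" using ne by auto
  ultimately obtain a b where ab: "{a, b} \<in> E" "a \<in> set w" "b \<in> V - set w"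
    using connected_crossing[OF assms(1)] by blast
  obtain w1 w2 where w: "w = w1 @ a # w2" using ab(2) by (meson split_list)
  let ?w = "w1 @ a # b # a # w2"
  have "walk_edges ?w = {#{a, b}, {a, b}#} + walk_edges w"
    using walk_edges_join[of w1 a "b # a # w2"] walk_edges_join[of w1 a w2] w
    by (simp add: insert_commute)
  then have "rel_walk (arcs E) ?w" using ne(3) ab by (auto simp: rel_walk_arcs_iff)
  then have "is_walk V E ?w" using ne w ab by (auto simp: is_walk_iff)
  moreover have "hd ?w = last ?w" using Suc.prems(2) w by (cases w1) auto
  moreover have "V - set ?w = (V - set w) - {b}" using w by auto
  then have "n = card (V - set ?w)" using Suc.hyps(2) ab by simp
  ultimately obtain w' where "tsp_tour V E w'" "walk_length w' = walk_length ?w + 2 * card (V - set ?w)"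
    using Suc.hyps(1)[of ?w] by blast
  moreover have "walk_length ?w = walk_length w + 2" using w by (simp add: walk_length_def)
  ultimately show ?case using Suc.hyps(2) \<open>n = card (V - set ?w)\<close> by auto
qed

text \<open>\<open>J1\<close> collects the edges preceded by an odd number of vertices of
  \<open>U\<close>, so sides are switched exactly at \<open>U\<close>. For odd \<open>card U\<close>
  an edge following \<open>last p\<close> would fall into \<open>J1\<close>; the correction term
  accounts for its absence.\<close>

lemma path_join_split:
  assumes "p \<noteq> []" "distinct p" "U \<subseteq> set p"
  shows "\<exists>J1 J2. J1 + J2 = walk_edges p \<and>
    (\<forall>v. odd (mdegree J1 v) \<longleftrightarrow> (v \<in> U) \<noteq> (v = last p \<and> odd (card U)))"
  using assms
proof (induction p arbitrary: U rule: rev_nonempty_induct)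
  case (single x)
  then have "U = {} \<or> U = {x}" by auto
  then show ?case by auto
next
  case (snoc z p)
  let ?O = "U - {z}"
  have z: "z \<notin> set p" "p \<noteq> []" using snoc by auto
  obtain J1 J2 where J: "J1 + J2 = walk_edges p"
      "\<And>v. odd (mdegree J1 v) \<longleftrightarrow> (v \<in> ?O) \<noteq> (v = last p \<and> odd (card ?O))"
    using snoc.IH[of ?O] snoc.prems by auto
  have fin: "finite U" using snoc.prems(2) finite_subset by blast
  have cO: "odd (card U) \<longleftrightarrow> odd (card ?O) \<noteq> (z \<in> U)"
  proof (cases "z \<in> U")
    case True
    then show ?thesis using card_Suc_Diff1[OF fin True, symmetric] by presburger
  qed simp
  have lz: "last p \<noteq> z" using z last_in_set by metis
  show ?case
  proof (cases "odd (card ?O)")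
    case True
    have "add_mset {last p, z} J1 + J2 = walk_edges (p @ [z])"
      using J(1) z by (simp add: walk_edges_snoc)
    moreover have "odd (mdegree (add_mset {last p, z} J1) v) \<longleftrightarrow>
        (v \<in> U) \<noteq> (v = last (p @ [z]) \<and> odd (card U))" for v
      using J(2)[of v] True cO lz by auto
    ultimately show ?thesis by blast
  next
    case False
    have "J1 + add_mset {last p, z} J2 = walk_edges (p @ [z])"
      using J(1) z by (simp add: walk_edges_snoc)
    moreover have "odd (mdegree J1 v) \<longleftrightarrow> (v \<in> U) \<noteq> (v = last (p @ [z]) \<and> odd (card U))" for v
      using J(2)[of v] False cO lz by auto
    ultimately show ?thesis by blast
  qed
qed

section \<open>Dirac's theorem on cycles through prescribed vertices\<close>

lemma shorten_to_path:
  assumes "rel_walk r p"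
  shows "\<exists>q. rel_walk r q \<and> distinct q \<and> hd q = hd p \<and> last q = last p \<and> set q \<subseteq> set p"
  using assms
proof (induction "length p" arbitrary: p rule: less_induct)
  case less
  show ?case
  proof (cases "distinct p")
    case False
    then obtain a x b c where p: "p = a @ [x] @ b @ [x] @ c" using not_distinct_decomp by blast
    let ?q = "a @ x # c"
    have "rel_walk r (a @ [x])" using rel_walk_prefix[of r a x "b @ x # c"] less.prems p by simp
    moreover have "rel_walk r (x # c)" using rel_walk_suffix[of r "a @ x # b" x c] less.prems p by simp
    ultimately have "rel_walk r ?q" by (rule rel_walk_join)
    moreover have "length ?q < length p" using p by simp
    ultimately obtain q where "rel_walk r q" "distinct q" "hd q = hd ?q" "last q = last ?q" "set q \<subseteq> set ?q"
      using less.hyps[of ?q] by blast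
    moreover have "hd ?q = hd p" "last ?q = last p" "set ?q \<subseteq> set p" using p by (cases a; auto)+
    ultimately show ?thesis by (intro exI[of _ q]) auto
  qed (use less.prems in blast)
qed

section \<open>Paths and fans from vertex connectivity\<close>

lemma k_connected_path:
  assumes "k_vertex_connected k V E" "S \<subseteq> V" "card S < k" "u \<in> V - S" "v \<in> V - S"
  shows "\<exists>p. rel_walk (arcs E) p \<and> distinct p \<and> hd p = u \<and> last p = v \<and> set p \<subseteq> V - S"
proof -
  obtain w where w: "is_walk (V - S) (del_vertices_edges E S) w" "hd w = u" "last w = v"
    using assms unfolding k_vertex_connected_def connected_graph_def by blast
  then have "rel_walk (arcs (del_vertices_edges E S)) w" and wS: "set w \<subseteq> V - S"
    by (auto simp: is_walk_iff)
  moreover have "arcs (del_vertices_edges E S) \<subseteq> arcs E" by (auto simp: arcs_def del_vertices_edges_def)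
  ultimately have "rel_walk (arcs E) w" by (metis rel_walk_mono)
  from shorten_to_path[OF this] obtain q where
    "rel_walk (arcs E) q" "distinct q" "hd q = hd w" "last q = last w" "set q \<subseteq> set w" by blast
  with w wS show ?thesis by (intro exI[of _ q]) auto
qed

lemma simple_graph_edge:
  assumes "simple_graph V E" "e \<in> E"
  shows "card e = 2" "e \<subseteq> V"
  using assms by (auto simp: simple_graph_def)

lemma simple_graph_pair:
  assumes "simple_graph V E" "{a, b} \<in> E"
  shows "a \<in> V" "b \<in> V" "a \<noteq> b"
  using simple_graph_edge[OF assms] by auto

lemma simple_graph_finite:
  assumes "simple_graph V E"
  shows "finite V" "finite E" "finite (arcs E)"
proof -
  show V: "finite V" using assms by (simp add: simple_graph_def)
  have "E \<subseteq> Pow V" using simple_graph_edge[OF assms] by auto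
  then show "finite E" using V by (meson finite_Pow_iff finite_subset)
  have "arcs E \<subseteq> V \<times> V" using simple_graph_pair[OF assms] by (auto simp: arcs_def)
  then show "finite (arcs E)" using V by (meson finite_SigmaI finite_subset)
qed

lemma rel_walk_subset:
  assumes "rel_walk r p" "hd p \<in> V" "r \<subseteq> V \<times> V"
  shows "set p \<subseteq> V"
  using assms
proof (induction p rule: induct_list012)
  case (3 x y p)
  then show ?case by (auto simp: rel_walk_def)
qed auto

lemma rel_walk_truncate:
  assumes "rel_walk r p" "distinct p" "last p \<in> C"
  shows "\<exists>q. rel_walk r q \<and> distinct q \<and> hd q = hd p \<and> last q \<in> C \<and>
    set (butlast q) \<inter> C = {} \<and> set q \<subseteq> set p"
proof -
  have "last p \<in> set p" using assms(1) by (simp add: rel_walk_def)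
  with assms(3) have "\<exists>z\<in>set p. z \<in> C" by blast
  from split_list_first_prop[OF this] obtain p1 z p2
    where p: "p = p1 @ z # p2" "z \<in> C" "\<forall>u\<in>set p1. u \<notin> C" by metis
  have "rel_walk r (p1 @ [z])" using rel_walk_prefix assms(1) p(1) by metis
  moreover have "hd (p1 @ [z]) = hd p" using p(1) by (cases p1) auto
  ultimately show ?thesis using p assms(2) by (intro exI[of _ "p1 @ [z]"]) auto
qed

text \<open>Menger's theorem from the neighbours of \<open>x\<close> to \<open>C\<close>, in the
  graph without \<open>x\<close>. Deleting fewer than \<open>m\<close> vertices leaves
  \<open>x\<close> connected to any remaining vertex of \<open>C\<close>, so no small set separates.
  The minimum is there because \<open>C\<close> may have fewer than \<open>m\<close>
  vertices.\<close>

lemma fan: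
  assumes G: "simple_graph V E" and conn: "k_vertex_connected m V E"
    and x: "x \<in> V" "x \<notin> C" and C: "C \<subseteq> V"
  shows "\<exists>\<P>. card \<P> = min m (card C) \<and>
    (\<forall>p\<in>\<P>. p \<noteq> [] \<and> rel_walk (arcs E) (x # p) \<and> distinct (x # p) \<and> set p \<subseteq> V \<and>
       last p \<in> C \<and> set (butlast p) \<inter> C = {}) \<and>
    (\<forall>p\<in>\<P>. \<forall>q\<in>\<P>. p \<noteq> q \<longrightarrow> set p \<inter> set q = {})"
proof -
  define r where "r = {(a, b) \<in> arcs E. a \<noteq> x \<and> b \<noteq> x}"
  define A where "A = {a. {x, a} \<in> E}"
  have rE: "r \<subseteq> arcs E" by (auto simp: r_def)
  have rV: "r \<subseteq> (V - {x}) \<times> (V - {x})"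
    using simple_graph_pair[OF G] by (auto simp: r_def arcs_def)
  have AV: "A \<subseteq> V - {x}" using simple_graph_pair[OF G] unfolding A_def by blast
  have finr: "finite r" using simple_graph_finite(3)[OF G] rE by (rule finite_subset[rotated])
  have finA: "finite A" using AV simple_graph_finite(1)[OF G] by (meson finite_Diff finite_subset)
  have "min m (card C) \<le> card S" if S: "finite S" "separates r A C S" for S
  proof (rule ccontr)
    assume "\<not> min m (card C) \<le> card S"
    then have less: "card S < m" "card S < card C" by auto
    then have "\<not> C \<subseteq> S" using S(1) by (meson card_mono leD)
    then obtain c where c: "c \<in> C" "c \<notin> S" by blast
    \<comment> \<open>\<open>S\<close> is an arbitrary finite set. Only its vertices other than
      \<open>x\<close> can be deleted, since the path is to start at \<open>x\<close>.\<close>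
    let ?S = "S \<inter> V - {x}"
    have "card ?S \<le> card S" using S(1) by (intro card_mono) auto
    then obtain p where p: "rel_walk (arcs E) p" "distinct p" "hd p = x" "last p = c" "set p \<subseteq> V - ?S"
      using k_connected_path[OF conn, of ?S x c] less x c C by auto
    have "p \<noteq> []" using p(1) by (simp add: rel_walk_def)
    with p(3) obtain q where q: "p = x # q" by (cases p) auto
    have qne: "q \<noteq> []" using p(4) q c x by auto
    then have qE: "rel_walk (arcs E) q" "(x, hd q) \<in> arcs E"
      using p(1) q rel_walk_append[of "[x]" q "arcs E"] by auto
    have xq: "x \<notin> set q" using p(2) q by simp
    have "rel_walk r q" unfolding rel_walk_def
    proof
      show "successively (\<lambda>a b. (a, b) \<in> r) q"
        by (rule successively_mono[of "\<lambda>a b. (a, b) \<in> arcs E"])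
          (use qE xq in \<open>auto simp: rel_walk_def r_def\<close>)
    qed (rule qne)
    moreover have "hd q \<in> A" using qE by (simp add: A_def arcs_def)
    moreover have "last q \<in> C" using p(4) q qne c by auto
    ultimately obtain z where "z \<in> set q" "z \<in> S" using S(2) unfolding separates_def by blast
    then show False using p(5) q xq by auto
  qed
  then obtain \<P> where P: "linkage r A C \<P>" "card \<P> = min m (card C)"
    using menger[OF finr finA] by blast
  \<comment> \<open>The linked paths may touch \<open>C\<close> before their ends; each is cut at
    its first vertex in \<open>C\<close>.\<close>
  have "\<forall>p\<in>\<P>. \<exists>q. rel_walk r q \<and> distinct q \<and> hd q = hd p \<and> last q \<in> C \<and>
    set (butlast q) \<inter> C = {} \<and> set q \<subseteq> set p"
    using rel_walk_truncate P(1) unfolding linkage_def by metis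
  then obtain f where f: "\<And>p. p \<in> \<P> \<Longrightarrow> rel_walk r (f p) \<and> distinct (f p) \<and> hd (f p) = hd p \<and>
      last (f p) \<in> C \<and> set (butlast (f p)) \<inter> C = {} \<and> set (f p) \<subseteq> set p"
    by metis
  have disj: "set (f p) \<inter> set (f q) = {}" if "p \<in> \<P>" "q \<in> \<P>" "p \<noteq> q" for p q
  proof -
    have "set p \<inter> set q = {}" using P(1) that by (simp add: linkage_def)
    with f[OF that(1)] f[OF that(2)] show ?thesis by blast
  qed
  have "inj_on f \<P>"
  proof (rule inj_onI, rule ccontr)
    fix p q assume pq: "p \<in> \<P>" "q \<in> \<P>" "f p = f q" "p \<noteq> q"
    then have "set (f p) = {}" using disj[of p q] by simp
    then show False using f[OF pq(1)] by (simp add: rel_walk_def)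
  qed
  then have "card (f ` \<P>) = min m (card C)" using P(2) by (simp add: card_image)
  moreover have "f p \<noteq> [] \<and> rel_walk (arcs E) (x # f p) \<and> distinct (x # f p) \<and> set (f p) \<subseteq> V \<and>
       last (f p) \<in> C \<and> set (butlast (f p)) \<inter> C = {}" if p: "p \<in> \<P>" for p
  proof -
    have hdA: "hd (f p) \<in> A" using P(1) p f[OF p] by (simp add: linkage_def)
    have ne: "f p \<noteq> []" using f[OF p] by (simp add: rel_walk_def)
    have sub: "set (f p) \<subseteq> V - {x}" using rel_walk_subset[OF _ _ rV] f[OF p] hdA AV by blast
    have "rel_walk (arcs E) (f p)" using rel_walk_mono[OF _ rE] f[OF p] by blast
    then have "rel_walk (arcs E) (x # f p)"
      using rel_walk_append[of "[x]" "f p" "arcs E"] ne hdA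
      by (simp add: rel_walk_def A_def arcs_def)
    then show ?thesis using f[OF p] ne sub by auto
  qed
  moreover have "\<forall>p\<in>f ` \<P>. \<forall>q\<in>f ` \<P>. p \<noteq> q \<longrightarrow> set p \<inter> set q = {}"
  proof (intro ballI impI)
    fix p q assume "p \<in> f ` \<P>" "q \<in> f ` \<P>" "p \<noteq> q"
    then obtain p' q' where "p = f p'" "q = f q'" "p' \<in> \<P>" "q' \<in> \<P>" "p' \<noteq> q'" by blast
    then show "set p \<inter> set q = {}" using disj by simp
  qed
  ultimately show ?thesis by (intro exI[of _ "f ` \<P>"]) simp
qed

text \<open>
  In a closed tour of the cycle there are as many gaps between consecutive elements of S as there
  are elements of S; if every gap met Y, then Y - S would have at least that many elements.
\<close>

lemma consecutive_free_gap:
  assumes "length (filter (\<lambda>v. v \<in> S) L) > length (filter (\<lambda>v. v \<in> Y - S) L) + 1"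
  shows "\<exists>A c I c' B. L = A @ c # I @ c' # B \<and> c \<in> S \<and> c' \<in> S \<and> set I \<inter> (S \<union> Y) = {}"
  using assms
proof (induction "length L" arbitrary: L rule: less_induct)
  case less
  then obtain a L' where L: "L = a # L'" by (cases L) auto
  show ?case
  proof (cases "a \<in> S")
    case False
    then have "length (filter (\<lambda>v. v \<in> S) L') > length (filter (\<lambda>v. v \<in> Y - S) L') + 1"
      using less.prems L by (simp split: if_splits)
    with less.hyps[of L'] L obtain A c I c' B where
      "L' = A @ c # I @ c' # B" "c \<in> S" "c' \<in> S" "set I \<inter> (S \<union> Y) = {}" by auto
    then show ?thesis using L by (intro exI[of _ "a # A"]) auto
  next
    case True
    then have "filter (\<lambda>v. v \<in> S) L' \<noteq> []" using less.prems L by auto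
    then have "\<exists>z\<in>set L'. z \<in> S" by (auto simp: filter_empty_conv)
    from split_list_first_prop[OF this] obtain I c B
      where L': "L' = I @ c # B" "c \<in> S" "\<forall>u\<in>set I. u \<notin> S" by metis
    show ?thesis
    proof (cases "set I \<inter> Y = {}")
      case True
      then show ?thesis using L L' \<open>a \<in> S\<close> by (intro exI[of _ "[]"] exI[of _ a] exI[of _ I] exI[of _ c] exI[of _ B]) auto
    next
      case False
      then have "filter (\<lambda>v. v \<in> Y - S) I \<noteq> []" using L'(3) by (auto simp: filter_empty_conv)
      then have "length (filter (\<lambda>v. v \<in> Y - S) I) \<ge> 1" by (cases "filter (\<lambda>v. v \<in> Y - S) I") auto
      moreover have "filter (\<lambda>v. v \<in> S) I = []" using L'(3) by (auto simp: filter_empty_conv)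
      \<comment> \<open>Dropping \<open>a\<close> and \<open>I\<close> loses one element of
        \<open>S\<close> and at least one of \<open>Y - S\<close>, so the surplus survives.\<close>
      ultimately have "length (filter (\<lambda>v. v \<in> S) (c # B)) > length (filter (\<lambda>v. v \<in> Y - S) (c # B)) + 1"
        using less.prems L L' \<open>a \<in> S\<close> by simp
      moreover have "length (c # B) < length L" using L L' by simp
      ultimately obtain A c1 I1 c' B1 where
        "c # B = A @ c1 # I1 @ c' # B1" "c1 \<in> S" "c' \<in> S" "set I1 \<inter> (S \<union> Y) = {}"
        using less.hyps[of "c # B"] by blast
      then show ?thesis using L L' by (intro exI[of _ "a # I @ A"]) auto
    qed
  qed
qed

text \<open>The cycle is cut open at some \<open>s\<close> in \<open>S\<close>, and \<open>s\<close>
  is repeated at the end so that the gap across the cut becomes a gap of the list. The repetition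
  also supplies the extra 1 that the version for lists demands.\<close>

lemma cyclic_free_gap:
  assumes C: "distinct C" "S \<subseteq> set C" "Y \<subseteq> set C"
    and S: "card S \<ge> 2" "card (Y - S) < card S"
  shows "\<exists>n c I c' J. rotate n C = c # I @ c' # J \<and> c \<in> S \<and> c' \<in> S \<and> set I \<inter> Y = {}"
proof -
  have "S \<noteq> {}" using S(1) by auto
  then obtain s where s: "s \<in> S" by blast
  with C(2) obtain X Z where XZ: "C = X @ s # Z" by (meson split_list subsetD)
  define L where "L = s # Z @ X"
  have L: "L = rotate (length X) C" using XZ rotate_append[of X "s # Z"] by (simp add: L_def)
  have dL: "distinct L" and sL: "set L = set C" using C(1) by (auto simp: L)
  have cnt: "length (filter (\<lambda>v. v \<in> W) L) = card W" if "W \<subseteq> set C" for W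
  proof -
    have "set (filter (\<lambda>v. v \<in> W) L) = W" using that sL by auto
    then show ?thesis using distinct_card[of "filter (\<lambda>v. v \<in> W) L"] dL by simp
  qed
  have "length (filter (\<lambda>v. v \<in> S) (L @ [s])) = card S + 1" using cnt[of S] C(2) s by simp
  moreover have "length (filter (\<lambda>v. v \<in> Y - S) (L @ [s])) = card (Y - S)"
    using cnt[of "Y - S"] C(3) s by auto
  ultimately obtain A c I c' B where d: "L @ [s] = A @ c # I @ c' # B" "c \<in> S" "c' \<in> S"
      "set I \<inter> (S \<union> Y) = {}"
    using consecutive_free_gap[of Y S "L @ [s]"] S(2) by auto
  show ?thesis
  proof (cases B rule: rev_cases)
    case Nil
    then have L1: "L = A @ c # I" "c' = s" using d(1) by auto
    \<comment> \<open>Here the gap ends at the repeated \<open>s\<close>. If \<open>A\<close> were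
      empty, it would run once around from \<open>s\<close> to itself and \<open>S\<close> would be
      a singleton.\<close>
    have "A \<noteq> []"
    proof
      assume "A = []"
      then have "S \<subseteq> {c}" using L1(1) sL C(2) d(4) by auto
      then have "card S \<le> card {c}" by (intro card_mono) auto
      then show False using S(1) by simp
    qed
    then obtain A' where A': "A = s # A'" using L1(1) by (cases A) (auto simp: L_def)
    have "rotate (length A) L = c # I @ c' # A'"
      using L1 A' rotate_append[of A "c # I"] by simp
    then show ?thesis using d L by (metis inf_sup_distrib1 rotate_rotate sup_eq_bot_iff)
  next
    case (snoc B' t)
    then have "L = A @ c # I @ c' # B'" using d(1) by auto
    then have "rotate (length A) L = c # I @ c' # (B' @ A)"
      using rotate_append[of A "c # I @ c' # B'"] by simp
    then show ?thesis using d L by (metis inf_sup_distrib1 rotate_rotate sup_eq_bot_iff)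
  qed
qed

section \<open>Rotating, finding and rerouting cycles\<close>

lemma is_cycle_iff:
  "is_cycle V E c \<longleftrightarrow> length c \<ge> 3 \<and> distinct c \<and> rel_walk (arcs E) c \<and> set c \<subseteq> V \<and> (last c, hd c) \<in> arcs E"
  by (auto simp: is_cycle_def is_walk_iff arcs_def)

lemma is_cycle_rotate: "is_cycle V E c \<Longrightarrow> is_cycle V E (rotate n c)"
proof (induction n)
  case (Suc n)
  then have cyc: "is_cycle V E (rotate n c)" by blast
  then obtain a d where d: "rotate n c = a # d" "d \<noteq> []"
    by (cases "rotate n c" rule: remdups_adj.cases) (auto simp: is_cycle_iff)
  have "rel_walk (arcs E) d" "(a, hd d) \<in> arcs E" "(last d, a) \<in> arcs E"
    using cyc d rel_walk_append[of "[a]" d "arcs E"] by (auto simp: is_cycle_iff)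
  then have "is_cycle V E (d @ [a])"
    using cyc d rel_walk_append[of d "[a]" "arcs E"] by (auto simp: is_cycle_iff rel_walk_def)
  then show ?case using d by simp
qed simp

text \<open>Two neighbours of a vertex \<open>u\<close> are joined by a path avoiding
  \<open>u\<close>. A neighbour of \<open>x\<close> other than \<open>a\<close> exists because
  deleting \<open>a\<close> leaves \<open>x\<close> connected to a third vertex.\<close>

lemma cycle_exists:
  assumes G: "simple_graph V E" and conn: "k_vertex_connected m V E" "m \<ge> 2"
  shows "\<exists>c. is_cycle V E c"
proof -
  have fin: "finite V" using G simple_graph_finite by blast
  have cV: "card V > 2" using conn by (auto simp: k_vertex_connected_def)
  have nbr: "\<exists>b. {x, b} \<in> E \<and> b \<noteq> a" if xa: "x \<in> V" "x \<noteq> a" "a \<in> V" for x a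
  proof -
    have "card {x, a} < card V" using cV xa by simp
    then obtain y where y: "y \<in> V" "y \<notin> {x, a}"
      using fin by (metis card_mono finite.emptyI finite.insertI leD subsetI)
    obtain p where p: "rel_walk (arcs E) p" "hd p = x" "last p = y" "set p \<subseteq> V - {a}"
      using k_connected_path[OF conn(1), of "{a}" x y] conn(2) xa y by auto
    then obtain b p' where "p = x # b # p'"
      using y by (cases p rule: remdups_adj.cases) (auto simp: rel_walk_def)
    then show ?thesis using p by (auto simp: rel_walk_def arcs_def)
  qed
  obtain u v where "u \<in> V" "v \<in> V" "u \<noteq> v"
    using cV fin by (metis One_nat_def Suc_1 card_le_Suc0_iff_eq less_imp_le_nat not_less_eq_eq)
  then obtain a where a: "{u, a} \<in> E" using nbr by blast
  then have aV: "a \<in> V" "u \<noteq> a" using simple_graph_pair[OF G a] by auto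
  obtain b where b: "{u, b} \<in> E" "b \<noteq> a" using nbr[OF \<open>u \<in> V\<close> aV(2,1)] by blast
  then have bV: "b \<in> V" "u \<noteq> b" using simple_graph_pair[OF G b(1)] by auto
  obtain p where p: "rel_walk (arcs E) p" "distinct p" "hd p = a" "last p = b" "set p \<subseteq> V - {u}"
    using k_connected_path[OF conn(1), of "{u}" a b] conn(2) \<open>u \<in> V\<close> aV bV by auto
  have ne: "p \<noteq> []" using p(1) by (simp add: rel_walk_def)
  have "length p \<ge> 2" using p(3,4) b(2) ne by (cases p rule: remdups_adj.cases) auto
  moreover have "rel_walk (arcs E) (u # p)"
    using rel_walk_append[of "[u]" p "arcs E"] p a ne by (simp add: rel_walk_def arcs_def)
  ultimately have "is_cycle V E (u # p)"
    using p b ne \<open>u \<in> V\<close> by (auto simp: is_cycle_iff arcs_def insert_commute)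
  then show ?thesis by blast
qed

text \<open>The stretch \<open>I\<close> is given up for the two fan paths: from \<open>x\<close>
  out along \<open>p'\<close> to \<open>c'\<close>, along the rest \<open>J\<close> of the cycle to
  \<open>c\<close>, and back along \<open>p\<close>.\<close>

lemma cycle_reroute:
  assumes cyc: "is_cycle V E (c # I @ c' # J)" and x: "x \<in> V" "x \<notin> set (c # I @ c' # J)"
    and p: "rel_walk (arcs E) (x # p)" "distinct (x # p)" "set p \<subseteq> V" "p \<noteq> []"
      "last p = c" "set (butlast p) \<inter> set (c # I @ c' # J) = {}"
    and p': "rel_walk (arcs E) (x # p')" "distinct (x # p')" "set p' \<subseteq> V" "p' \<noteq> []"
      "last p' = c'" "set (butlast p') \<inter> set (c # I @ c' # J) = {}"
    and disj: "set p \<inter> set p' = {}"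
  shows "is_cycle V E (x # p' @ J @ rev p)"
proof -
  obtain q where q: "p = q @ [c]" using p(4,5) by (metis append_butlast_last_id)
  obtain q' where q': "p' = q' @ [c']" using p'(4,5) by (metis append_butlast_last_id)
  have cw: "rel_walk (arcs E) ((c # I) @ c' # J)" "(last (c' # J), c) \<in> arcs E"
    and cd: "distinct (c # I @ c' # J)" "set (c # I @ c' # J) \<subseteq> V"
    using cyc by (auto simp: is_cycle_iff)
  have "rel_walk (arcs E) (c' # J)" using cw(1) by (rule rel_walk_suffix)
  then have "rel_walk (arcs E) ((c' # J) @ [c])"
    using cw(2) rel_walk_append[of "c' # J" "[c]" "arcs E"] by (simp add: rel_walk_def)
  moreover have "rel_walk (arcs E) p" "(x, hd p) \<in> arcs E"
    using p(1,4) rel_walk_append[of "[x]" p "arcs E"] by auto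
  then have "rel_walk (arcs E) (c # rev q)" using rel_walk_arcs_rev[of E p] q by simp
  ultimately have "rel_walk (arcs E) (c' # J @ c # rev q)"
    using rel_walk_join[of "arcs E" "c' # J" c "rev q"] by simp
  moreover have "rel_walk (arcs E) ((x # q') @ [c'])" using p'(1) q' by simp
  ultimately have "rel_walk (arcs E) ((x # q') @ c' # J @ c # rev q)" by (rule rel_walk_join[rotated])
  then have w: "rel_walk (arcs E) (x # p' @ J @ rev p)" using q q' by simp
  have "last (x # p' @ J @ rev p) = hd p" using p(4) by (simp add: last_rev)
  then have "(last (x # p' @ J @ rev p), x) \<in> arcs E"
    using \<open>(x, hd p) \<in> arcs E\<close> by (simp add: arcs_def insert_commute)
  moreover have "distinct (x # p' @ J @ rev p)"
    using p(2,6) p'(2,6) cd(1) x(2) disj q q' by auto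
  moreover have "set (x # p' @ J @ rev p) \<subseteq> V" using x(1) p(3) p'(3) cd(2) by auto
  moreover have "length (x # p' @ J @ rev p) \<ge> 3" using q q' by simp
  ultimately show ?thesis using w by (simp add: is_cycle_iff)
qed

text \<open>Prescribed vertices are added one at a time. The fan from \<open>x\<close> has more ends
  \<open>S\<close> on the cycle than there are elements of \<open>X - S\<close>, so a stretch
  between two ends is free of \<open>X\<close> and can be rerouted through \<open>x\<close>.\<close>

theorem dirac_cycle:
  assumes G: "simple_graph V E" and conn: "k_vertex_connected m V E" "m \<ge> 2"
    and X: "X \<subseteq> V" "card X \<le> m"
  shows "\<exists>c. is_cycle V E c \<and> X \<subseteq> set c"
proof -
  have "finite X" using X(1) simple_graph_finite(1)[OF G] by (rule finite_subset)
  then show ?thesis using X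
  proof (induction X rule: finite_induct)
    case empty
    then show ?case using cycle_exists[OF G conn] by blast
  next
    case (insert x X)
    then have xV: "x \<in> V" and cX: "card X < m" by auto
    from insert obtain C where C: "is_cycle V E C" "X \<subseteq> set C" by auto
    show ?case
    proof (cases "x \<in> set C")
      case True
      then show ?thesis using C by blast
    next
      case False
      have CV: "set C \<subseteq> V" and C3: "distinct C" "length C \<ge> 3" using C(1) by (auto simp: is_cycle_iff)
      then have card_C: "card (set C) \<ge> 3" by (simp add: distinct_card)
      obtain \<P> where P: "card \<P> = min m (card (set C))"
        and Pp: "\<And>p. p \<in> \<P> \<Longrightarrow> p \<noteq> [] \<and> rel_walk (arcs E) (x # p) \<and> distinct (x # p) \<and>
           set p \<subseteq> V \<and> last p \<in> set C \<and> set (butlast p) \<inter> set C = {}"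
        and Pd: "\<And>p q. p \<in> \<P> \<Longrightarrow> q \<in> \<P> \<Longrightarrow> p \<noteq> q \<Longrightarrow> set p \<inter> set q = {}"
        using fan[OF G conn(1) xV False CV] by metis
      define S where "S = last ` \<P>"
      have "inj_on last \<P>"
      proof (rule inj_onI, rule ccontr)
        fix p q assume pq: "p \<in> \<P>" "q \<in> \<P>" "last p = last q" "p \<noteq> q"
        then have "last p \<in> set p \<inter> set q" using Pp[OF pq(1)] Pp[OF pq(2)] last_in_set by (metis IntI)
        then show False using Pd[OF pq(1,2,4)] by blast
      qed
      then have cS: "card S = min m (card (set C))" using P by (simp add: S_def card_image)
      have SC: "S \<subseteq> set C" using Pp by (auto simp: S_def)
      \<comment> \<open>A full fan of \<open>m\<close> paths outnumbers \<open>X\<close>; on a cycle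
        with fewer than \<open>m\<close> vertices the fan reaches all of them and
        \<open>X - S\<close> is empty.\<close>
      have "card (X - S) < card S"
      proof (cases "m \<le> card (set C)")
        case True
        have "card (X - S) \<le> card X" using insert.hyps(1) by (intro card_mono) auto
        then show ?thesis using True cX cS by simp
      next
        case False
        then have "S = set C" using cS SC by (simp add: card_subset_eq)
        then have "X - S = {}" using C(2) by blast
        then have "card (X - S) = 0" by (simp only: card.empty)
        then show ?thesis using cS conn(2) card_C by linarith
      qed
      moreover have "card S \<ge> 2" using cS conn(2) card_C by linarith
      ultimately obtain n c I c' J where rot: "rotate n C = c # I @ c' # J"
        and cc: "c \<in> S" "c' \<in> S" "set I \<inter> X = {}"
        using cyclic_free_gap[OF C3(1) SC C(2)] by blast
      have cyc: "is_cycle V E (c # I @ c' # J)" using is_cycle_rotate[OF C(1), of n] rot by simp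
      have sC: "set C = set (c # I @ c' # J)" using rot by (metis set_rotate)
      obtain p where p: "p \<in> \<P>" "last p = c" using cc(1) by (auto simp: S_def)
      obtain p' where p': "p' \<in> \<P>" "last p' = c'" using cc(2) by (auto simp: S_def)
      have "c \<noteq> c'" using cyc by (auto simp: is_cycle_iff)
      then have "set p \<inter> set p' = {}" using Pd p p' by metis
      then have new: "is_cycle V E (x # p' @ J @ rev p)"
        using cycle_reroute[OF cyc xV] Pp[OF p(1)] Pp[OF p'(1)] p p' False sC by auto
      have "c \<in> set p" "c' \<in> set p'" using Pp[OF p(1)] Pp[OF p'(1)] p p' last_in_set by metis+
      then have "insert x X \<subseteq> set (x # p' @ J @ rev p)" using C(2) sC cc(3) by auto
      with new show ?thesis by blast
    qed
  qed
qed

section \<open>Trees and the three tours\<close>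

text \<open>All neighbours of an endpoint of a longest path lie on the path, and a second one would
  close a cycle.\<close>

lemma low_degree_vertex:
  assumes G: "simple_graph V T" and "acyclic_graph V T" "V \<noteq> {}"
  shows "\<exists>v\<in>V. degree T v \<le> 1"
proof (rule ccontr)
  assume "\<not> (\<exists>v\<in>V. degree T v \<le> 1)"
  then have deg: "\<And>v. v \<in> V \<Longrightarrow> degree T v \<ge> 2" by force
  have nbr: "\<exists>y. {v, y} \<in> T \<and> y \<noteq> u" if "v \<in> V" for v u
  proof -
    have "finite {e \<in> T. v \<in> e}" using simple_graph_finite(2)[OF G] by simp
    moreover have "\<not> card {e \<in> T. v \<in> e} \<le> Suc 0" using deg[OF that] by (simp add: degree_def)
    ultimately obtain e where e: "e \<in> T" "v \<in> e" "e \<noteq> {v, u}"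
      by (auto simp: card_le_Suc0_iff_eq)
    then obtain y where "e = {v, y}" using simple_graph_edge(1)[OF G e(1)] by (auto simp: card_2_iff)
    then show ?thesis using e by auto
  qed
  define P where "P p \<longleftrightarrow> rel_walk (arcs T) p \<and> distinct p \<and> set p \<subseteq> V" for p
  obtain r where "r \<in> V" using assms(3) by blast
  then have "P [r]" by (simp add: P_def rel_walk_def)
  moreover have "\<forall>p. P p \<longrightarrow> length p < card V + 1"
    using simple_graph_finite(1)[OF G] by (metis P_def card_mono distinct_card less_Suc_eq_le Suc_eq_plus1)
  ultimately obtain p where p: "P p" and max: "\<And>q. P q \<Longrightarrow> length q \<le> length p"
    using ex_has_greatest_nat[of P "[r]" length "card V + 1"] by blast
  have extend: "y \<in> set p" if "{hd p, y} \<in> T" for y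
  proof (rule ccontr)
    assume "y \<notin> set p"
    moreover have "p \<noteq> []" using p by (simp add: P_def rel_walk_def)
    ultimately have "P (y # p)"
      using p that simple_graph_pair[OF G that] rel_walk_append[of "[y]" p "arcs T"]
      by (auto simp: P_def rel_walk_def arcs_def insert_commute)
    then show False using max by fastforce
  qed
  obtain v p' where vp: "p = v # p'" using p by (cases p) (auto simp: P_def rel_walk_def)
  then have vV: "v \<in> V" using p by (auto simp: P_def)
  show False
  proof (cases p')
    case Nil
    obtain y where "{v, y} \<in> T" "y \<noteq> v" using nbr[OF vV] by blast
    then show False using extend[of y] vp Nil by auto
  next
    case (Cons u p'')
    obtain y where y: "{v, y} \<in> T" "y \<noteq> u" using nbr[OF vV] by blast
    then have "y \<in> set p''" using extend[of y] vp Cons simple_graph_pair[OF G y(1)] by auto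
    then obtain a b where ab: "p'' = a @ y # b" by (meson split_list)
    then have pd: "p = (v # u # a) @ y # b" using vp Cons by simp
    then have "rel_walk (arcs T) ((v # u # a) @ [y])" using p rel_walk_prefix unfolding P_def by metis
    then have "is_cycle V T (v # u # a @ [y])"
      using p pd y by (auto simp: is_cycle_iff P_def arcs_def insert_commute)
    then show False using assms(2) by (auto simp: acyclic_graph_def)
  qed
qed

text \<open>Deleting a vertex of degree at most 1 removes at most one edge and keeps the graph
  acyclic.\<close>

lemma acyclic_card_less:
  assumes "simple_graph V T" "acyclic_graph V T" "V \<noteq> {}"
  shows "card T < card V"
  using assms
proof (induction "card V" arbitrary: V T)
  case 0
  then show ?case using simple_graph_finite(1) by fastforce
next
  case (Suc n)
  note fin = simple_graph_finite[OF Suc.prems(1)]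
  obtain v where v: "v \<in> V" "degree T v \<le> 1" using low_degree_vertex[OF Suc.prems] by blast
  let ?T = "{e \<in> T. v \<notin> e}" and ?V = "V - {v}"
  have cV: "card ?V = n" using Suc.hyps(2) v(1) by simp
  have "T = ?T \<union> {e \<in> T. v \<in> e}" by blast
  then have "card T \<le> card ?T + card {e \<in> T. v \<in> e}" by (metis card_Un_le)
  then have cT: "card T \<le> card ?T + 1" using v(2) by (simp add: degree_def)
  show ?case
  proof (cases "?V = {}")
    case True
    then have "V = {v}" using v(1) by blast
    then have "T = {}" using Suc.prems(1) by (auto simp: simple_graph_def)
    then show ?thesis using Suc.hyps(2) by (metis card.empty zero_less_Suc)
  next
    case False
    have "simple_graph ?V ?T" unfolding simple_graph_def
    proof (intro conjI ballI)
      fix e assume e: "e \<in> ?T"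
      then obtain a b where "e = {a, b}" "a \<noteq> b" "a \<in> V" "b \<in> V"
        using Suc.prems(1) unfolding simple_graph_def by blast
      then show "\<exists>a b. e = {a, b} \<and> a \<noteq> b \<and> a \<in> ?V \<and> b \<in> ?V" using e by blast
    qed (use fin in simp)
    moreover have "acyclic_graph ?V ?T"
      using Suc.prems(2) unfolding acyclic_graph_def is_cycle_def is_walk_def by blast
    ultimately have "card ?T < card ?V" using Suc.hyps(1)[of ?V ?T] cV False by simp
    then show ?thesis using cT cV Suc.hyps(2) by linarith
  qed
qed

section \<open>Degree sums and odd vertices\<close>

lemma sum_degree:
  assumes "simple_graph V T"
  shows "(\<Sum>v\<in>V. degree T v) = 2 * card T"
proof -
  have "card {v \<in> V. v \<in> e} = 2" if "e \<in> T" for e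
  proof -
    have "{v \<in> V. v \<in> e} = e" using simple_graph_edge(2)[OF assms that] by blast
    then show ?thesis using simple_graph_edge(1)[OF assms that] by simp
  qed
  then have "(\<Sum>v\<in>V. card {e \<in> T. v \<in> e}) = (\<Sum>e\<in>T. 2)"
    using simple_graph_finite[OF assms] by (intro sum_multicount_gen) auto
  then show ?thesis by (simp add: degree_def)
qed

lemma connected_degree_pos:
  assumes G: "simple_graph V T" and "connected_graph V T" "card V \<ge> 2" "v \<in> V"
  shows "degree T v \<ge> 1"
proof -
  have "\<not> V \<subseteq> {v}"
  proof
    assume "V \<subseteq> {v}"
    then have "card V \<le> card {v}" by (intro card_mono) auto
    then show False using assms(3) by simp
  qed
  then obtain u where "u \<in> V - {v}" by blast
  then obtain a b where "{a, b} \<in> T" "a \<in> V \<inter> {v}"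
    using connected_crossing[OF assms(2), of v "{v}" u] assms(4) by blast
  then have "{a, b} \<in> {e \<in> T. v \<in> e}" by blast
  then have "card {e \<in> T. v \<in> e} > 0"
    using simple_graph_finite(2)[OF G] by (subst card_gt_0_iff) auto
  then show ?thesis by (simp add: degree_def)
qed

lemma odd_vertices_bound:
  assumes G: "simple_graph V T" and T: "connected_graph V T" "acyclic_graph V T" and V: "card V \<ge> 2"
  shows "card {v \<in> V. odd (degree T v)} + 2 \<le> 2 * card (leaves V T)"
proof -
  let ?O = "{v \<in> V. odd (degree T v)}"
  have fin: "finite V" using simple_graph_finite(1)[OF G] .
  have "card T < card V" using acyclic_card_less[OF G T(2)] V by fastforce
  \<comment> \<open>A leaf gives 3 <= 1 + 2; any other odd vertex has degree at least 3, and an even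
    one at least 2 because degree 0 is excluded. Summing over \<open>V\<close> turns this into the
    bound.\<close>
  have "2 + (of_bool (odd (degree T v)) :: nat) \<le> degree T v + 2 * of_bool (degree T v = 1)"
    if "v \<in> V" for v
  proof -
    have "degree T v \<ge> 1" by (rule connected_degree_pos[OF G T(1) V that])
    then show ?thesis by (cases "odd (degree T v)"; cases "degree T v = 1") (auto, presburger+)
  qed
  then have "(\<Sum>v\<in>V. 2 + (of_bool (odd (degree T v)) :: nat)) \<le>
      (\<Sum>v\<in>V. degree T v + 2 * of_bool (degree T v = 1))"
    by (rule sum_mono)
  moreover have "(\<Sum>v\<in>V. 2 + (of_bool (odd (degree T v)) :: nat)) = 2 * card V + card ?O"
    using fin by (simp only: sum.distrib) (simp add: sum_of_bool_eq Int_def)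
  moreover have "(\<Sum>v\<in>V. degree T v + 2 * of_bool (degree T v = 1)) = 2 * card T + 2 * card (leaves V T)"
    using fin sum_degree[OF G]
    by (simp add: sum.distrib sum_of_bool_eq Int_def leaves_def flip: sum_distrib_left)
  ultimately show ?thesis using \<open>card T < card V\<close> by linarith
qed

lemma even_card_odd_vertices:
  assumes "simple_graph V T"
  shows "even (card {v \<in> V. odd (degree T v)})"
  using even_sum_iff[of V "degree T"] sum_degree[OF assms] simple_graph_finite(1)[OF assms] by simp

text \<open>Edges common to \<open>T\<close> and \<open>J\<close> count twice in \<open>?M\<close>,
  so its degrees are the plain sums of both degrees.\<close>

lemma even_augmentation_tour:
  assumes G: "simple_graph V E" and "V \<noteq> {}" and T: "connected_graph V T" "T \<subseteq> E"
    and J: "set_mset J \<subseteq> E" "\<And>v. even (degree T v + mdegree J v)"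
  shows "\<exists>w. tsp_tour V E w \<and> walk_length w \<le> card T + size J"
proof -
  have finT: "finite T" using T(2) simple_graph_finite(2)[OF G] by (rule finite_subset)
  let ?M = "mset_set T + J"
  have ME: "set_mset ?M \<subseteq> E" using T(2) J(1) finT by simp
  have "\<forall>e\<in>#?M. card e = 2" "\<forall>e\<in>#?M. e \<subseteq> V" using simple_graph_edge[OF G] ME by blast+
  moreover have "\<forall>v. even (mdegree ?M v)" using J(2) finT by (simp add: mdegree_mset_set)
  moreover have "T \<subseteq> set_mset ?M" using finT by simp
  ultimately obtain w where w: "w \<noteq> []" "hd w = last w" "set w = V" "walk_edges w \<subseteq># ?M"
    using euler_tour[of ?M V T] \<open>V \<noteq> {}\<close> T(1) by blast
  have "size (walk_edges w) \<le> size ?M" using w(4) by (rule size_mset_mono)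
  then have "walk_length w \<le> card T + size J" by (simp add: size_walk_edges walk_length_def)
  moreover have "set_mset (walk_edges w) \<subseteq> E" using w(4) ME set_mset_mono by blast
  then have "tsp_tour V E w" using w by (simp add: tsp_tour_def is_walk_iff rel_walk_arcs_iff)
  ultimately show ?thesis by blast
qed

text \<open>\<open>J1\<close> and \<open>J2\<close> together form the cycle, where all degrees are
  even, so both are odd at the same vertices. As \<open>card U\<close> is even, the closing edge
  goes to \<open>J2\<close>.\<close>

lemma cycle_join_split:
  assumes G: "simple_graph V E" and c: "is_cycle V E c" and U: "U \<subseteq> set c" "even (card U)"
  shows "\<exists>J1 J2. size J1 + size J2 = length c \<and> set_mset (J1 + J2) \<subseteq> E \<and>
    (\<forall>v. odd (mdegree J1 v) \<longleftrightarrow> v \<in> U) \<and> (\<forall>v. odd (mdegree J2 v) \<longleftrightarrow> v \<in> U)"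
proof -
  have c': "c \<noteq> []" "distinct c" "rel_walk (arcs E) (c @ [hd c])"
    using c rel_walk_append[of c "[hd c]" "arcs E"] by (auto simp: is_cycle_iff rel_walk_def)
  let ?W = "walk_edges (c @ [hd c])"
  have WE: "set_mset ?W \<subseteq> E" using c'(3) by (simp add: rel_walk_arcs_iff)
  obtain J1 J2 where J: "J1 + J2 = walk_edges c" "\<And>v. odd (mdegree J1 v) \<longleftrightarrow> v \<in> U"
    using path_join_split[OF c'(1,2) U(1)] U(2) by auto
  let ?J2 = "add_mset {last c, hd c} J2"
  have W: "J1 + ?J2 = ?W" using J(1) c'(1) by (simp add: walk_edges_snoc)
  have "even (mdegree ?W v)" for v
    using odd_mdegree_walk[of "c @ [hd c]" v] simple_graph_edge(1)[OF G] WE c'(1) by auto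
  then have "odd (mdegree ?J2 v) \<longleftrightarrow> v \<in> U" for v
    using J(2)[of v] by (metis W even_add mdegree_simps(3))
  moreover have "size J1 + size ?J2 = length c"
    using arg_cong[OF W, of size] by (simp only: size_union size_walk_edges) simp
  ultimately show ?thesis using J(2) W WE by (intro exI[of _ J1] exI[of _ ?J2]) simp
qed

text \<open>Stated as a sum to avoid truncated subtraction.\<close>

lemma cycle_tour:
  assumes "connected_graph V E" "finite V" "is_cycle V E c"
  shows "\<exists>w. tsp_tour V E w \<and> walk_length w + length c = 2 * card V"
proof -
  have c: "c \<noteq> []" "distinct c" "set c \<subseteq> V" "is_walk V E (c @ [hd c])"
    using assms(3) rel_walk_append[of c "[hd c]" "arcs E"]
    by (auto simp: is_cycle_iff is_walk_iff rel_walk_def)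
  obtain w where w: "tsp_tour V E w"
      "walk_length w = walk_length (c @ [hd c]) + 2 * card (V - set (c @ [hd c]))"
    using extend_closed_walk[OF assms(1,2) c(4)] c(1) by auto
  have "set (c @ [hd c]) = set c" using c(1) by auto
  moreover have "card (V - set c) + length c = card V"
    using c assms(2) by (metis card_Diff_subset card_mono distinct_card finite_subset le_add_diff_inverse2)
  ultimately have "walk_length w + length c = 2 * card V" using w(2) by (simp add: walk_length_def)
  then show ?thesis using w(1) by blast
qed

theorem theorem3:
  fixes V :: "'a set" and E :: "'a set set" and k :: nat
  assumes "k \<ge> 2"
    and "simple_graph V E"
    and "k_vertex_connected (2 * (k - 1)) V E"
    and "k_vertex_connected 2 V E"
    and "\<exists>T. spanning_tree V E T \<and> card (leaves V T) = k"
  shows "\<exists>w. tsp_tour V E w \<and> real (walk_length w) \<le> 4 * real (card V) / 3"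
proof -
  note G = assms(2)
  obtain T where T: "T \<subseteq> E" "connected_graph V T" "acyclic_graph V T" "card (leaves V T) = k"
    using assms(5) by (auto simp: spanning_tree_def)
  have GT: "simple_graph V T" using G T(1) by (auto simp: simple_graph_def)
  have V: "card V > 2" using assms(4) by (simp add: k_vertex_connected_def)
  then have "V \<noteq> {}" by auto
  have "k_vertex_connected 2 V E \<Longrightarrow> connected_graph (V - {}) (del_vertices_edges E {})"
    unfolding k_vertex_connected_def by (metis card.empty empty_subsetI zero_less_numeral)
  then have conn: "connected_graph V E" using assms(4) by (simp add: del_vertices_edges_def)
  define D where "D = {v \<in> V. odd (degree T v)}"
  \<comment> \<open>The parity condition on an augmentation ranges over the whole type; outside
    \<open>V\<close> the degree is 0.\<close>
  have D_iff: "odd (degree T v) \<longleftrightarrow> v \<in> D" for v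
  proof -
    have "degree T v = 0" if "v \<notin> V"
    proof -
      have "{e \<in> T. v \<in> e} = {}" using simple_graph_edge(2)[OF GT] that by blast
      then show ?thesis unfolding degree_def by (metis card.empty)
    qed
    then show ?thesis by (cases "v \<in> V") (auto simp: D_def)
  qed
  have "card D \<le> 2 * (k - 1)"
    using odd_vertices_bound[OF GT T(2,3)] V T(4) assms(1) by (simp add: D_def)
  moreover have "2 * (k - 1) \<ge> 2" using assms(1) by simp
  moreover have "D \<subseteq> V" by (auto simp: D_def)
  ultimately obtain c where c: "is_cycle V E c" "D \<subseteq> set c"
    using dirac_cycle[OF G assms(3)] by blast
  obtain J1 J2 where J: "size J1 + size J2 = length c" "set_mset (J1 + J2) \<subseteq> E"
      "\<And>v. odd (mdegree J1 v) \<longleftrightarrow> v \<in> D" "\<And>v. odd (mdegree J2 v) \<longleftrightarrow> v \<in> D"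
    using cycle_join_split[OF G c] even_card_odd_vertices[OF GT, folded D_def] by blast
  obtain w1 where w1: "tsp_tour V E w1" "walk_length w1 \<le> card T + size J1"
    using even_augmentation_tour[OF G \<open>V \<noteq> {}\<close> T(2,1), of J1] J D_iff by auto
  obtain w2 where w2: "tsp_tour V E w2" "walk_length w2 \<le> card T + size J2"
    using even_augmentation_tour[OF G \<open>V \<noteq> {}\<close> T(2,1), of J2] J D_iff by auto
  obtain w3 where w3: "tsp_tour V E w3" "walk_length w3 + length c = 2 * card V"
    using cycle_tour[OF conn simple_graph_finite(1)[OF G] c(1)] by blast
  have "card T < card V" using acyclic_card_less[OF GT T(3) \<open>V \<noteq> {}\<close>] .
  \<comment> \<open>The length of the cycle cancels, leaving 2 |T| + 2n; the shortest tour is at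
    most a third of the sum.\<close>
  then have "walk_length w1 + walk_length w2 + walk_length w3 \<le> 4 * card V"
    using w1(2) w2(2) w3(2) J(1) by linarith
  then have "\<exists>w\<in>{w1, w2, w3}. 3 * walk_length w \<le> 4 * card V" by auto
  then obtain w where "tsp_tour V E w" "3 * walk_length w \<le> 4 * card V"
    using w1(1) w2(1) w3(1) by blast
  moreover from this(2) have "real (3 * walk_length w) \<le> real (4 * card V)"
    by (rule of_nat_mono)
  ultimately show ?thesis by (intro exI[of _ w]) simp
qed

end
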